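(* Let $V\in\{0,1\}^{\mathbb{N}}$ be an aperiodic, coupled infinite word. Then $V$ does not have a rank-one construction.
   Context: Coupled: for $a\in\{0,1\}$ let $a^c=1-a$. A finite word $u$ is coupled if $u=a_1a_1^c a_2a_2^c\cdots a_ka_k^c$ for some $k\ge1$ and $a_1,\dots,a_k\in\{0,1\}$. An infinite word is coupled if all of its initial segments of (positive) even length are coupled. An infinite word $V$ is periodic if $V=vvv\cdots$ for some finite word $v$; aperiodic means not periodic. Rank one: $\mathbb{N}$ is the set of nonnegative integers; $\mathcal{F}$ is the set of all finite words that start and end with $0$; $1^a$ is $a$ consecutive $1$s. A finite word $w$ is built from $v\in\mathcal{F}$ if $w=v1^{a_1}v1^{a_2}\cdots v1^{a_k}v$ for some $k\ge 1$ and $a_i\in\mathbb{N}$. An infinite word $V$ has a rank-one construction if there is a sequence $(v_i)_{i\in\mathbb{N}}$ in $\mathcal{F}$ with $v_0=0$, $v_{i+1}$ built from $v_i$ for all $i$, and $v_i$ an initial segment of $V$ for all $i$. *)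

theory Defs
  imports "HOL-Library.Z2" "HOL-Library.Omega_Words_Fun"
begin

text \<open>
  The alphabet {0,1} is the type \<^typ>\<open>bit\<close>, so the complementary letter of \<open>a\<close> is literally
  \<open>1 - a\<close>. Finite words are lists; infinite words are functions on the natural numbers, with
  \<^const>\<open>iter\<close> the infinite repetition of a nonempty finite word.
\<close>

definition coupled :: "bit list \<Rightarrow> bool" where
  "coupled u \<longleftrightarrow> (\<exists>as. as \<noteq> [] \<and> u = concat (map (\<lambda>a. [a, 1 - a]) as))"

definition coupled_inf :: "bit word \<Rightarrow> bool" where
  "coupled_inf V \<longleftrightarrow> (\<forall>n>0. even n \<longrightarrow> coupled (prefix n V))"

text \<open>
  The period starts at the first letter: an eventually periodic word need not be periodic.
\<close>

definition periodic :: "'a word \<Rightarrow> bool" where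
  "periodic V \<longleftrightarrow> (\<exists>v. v \<noteq> [] \<and> V = v\<^sup>\<omega>)"

definition initial_segment :: "'a list \<Rightarrow> 'a word \<Rightarrow> bool" where
  "initial_segment v V \<longleftrightarrow> (\<exists>n. v = prefix n V)"

definition words_0_0 :: "bit list set" where
  "words_0_0 = {v. v \<noteq> [] \<and> hd v = 0 \<and> last v = 0}"

definition built_from :: "bit list \<Rightarrow> bit list \<Rightarrow> bool" where
  "built_from w v \<longleftrightarrow>
     v \<in> words_0_0 \<and>
     (\<exists>as :: nat list. as \<noteq> [] \<and> w = concat (map (\<lambda>a. v @ replicate a 1) as) @ v)"

definition has_rank_one_construction :: "bit word \<Rightarrow> bool" where
  "has_rank_one_construction V \<longleftrightarrow>
     (\<exists>v :: nat \<Rightarrow> bit list.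
        (\<forall>i. v i \<in> words_0_0) \<and>
        v 0 = [0] \<and>
        (\<forall>i. built_from (v (Suc i)) (v i)) \<and>
        (\<forall>i. initial_segment (v i) V))"

end

theory Submission
  imports Defs
begin

text \<open>
  Let \<open>v = v\<^sub>i\<close> be a word of a rank-one construction of \<open>V\<close>. If \<open>v\<close> occurs in \<open>V\<close> both at an even and
  at an odd position, then coupling forces \<open>v\<close> to alternate. Otherwise all occurrences of \<open>v\<close> are at
  even positions, and since an aligned pair \<open>11\<close> is impossible, every spacer has length
  \<open>|v| mod 2\<close>, so that \<open>V\<close> is periodic. If, on the other hand, every \<open>v\<^sub>i\<close> alternates, then
  \<open>V = (01)\<^sup>\<omega>\<close>.
\<close>

definition occurs_at :: "'a word \<Rightarrow> nat \<Rightarrow> 'a list \<Rightarrow> bool" where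
  "occurs_at V s u \<longleftrightarrow> (\<forall>k<length u. V (s + k) = u ! k)"

definition alternating :: "bit list \<Rightarrow> bool" where
  "alternating u \<longleftrightarrow> (\<forall>k. Suc k < length u \<longrightarrow> u ! Suc k = 1 - u ! k)"

text \<open>Unlike in \<open>built_from\<close>, the spacer list may be empty. Thus \<open>v\<close>
  itself has the form \<open>spaced v []\<close>, which gives the inductions below their base
  case.\<close>

definition spaced :: "bit list \<Rightarrow> nat list \<Rightarrow> bit list" where
  "spaced v as = concat (map (\<lambda>a. v @ replicate a 1) as) @ v"

lemma occurs_at_append:
  "occurs_at V s (u @ w) \<longleftrightarrow> occurs_at V s u \<and> occurs_at V (s + length u) w"
proof
  assume L: "occurs_at V s (u @ w)"
  have "V (s + length u + k) = w ! k" if "k < length w" for k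
    using L[unfolded occurs_at_def, rule_format, of "length u + k"] that
    by (simp add: nth_append add.assoc)
  moreover have "V (s + k) = u ! k" if "k < length u" for k
    using L[unfolded occurs_at_def, rule_format, of k] that by (simp add: nth_append)
  ultimately show "occurs_at V s u \<and> occurs_at V (s + length u) w"
    by (simp add: occurs_at_def)
next
  assume R: "occurs_at V s u \<and> occurs_at V (s + length u) w"
  have "V (s + k) = (u @ w) ! k" if k: "k < length (u @ w)" for k
  proof (cases "k < length u")
    case True
    then show ?thesis using R by (simp add: occurs_at_def nth_append)
  next
    case False
    then show ?thesis
      using R[unfolded occurs_at_def, THEN conjunct2, rule_format, of "k - length u"] k
      by (simp add: nth_append add.assoc)
  qed
  then show "occurs_at V s (u @ w)" by (simp add: occurs_at_def)
qed

lemma occurs_at_initial_segment: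
  assumes "initial_segment u V"
  shows "occurs_at V 0 u"
  using assms by (auto simp: initial_segment_def occurs_at_def)

lemma nth_concat_pairs:
  assumes "k < length as"
  shows "concat (map (\<lambda>a. [f a, g a]) as) ! (2 * k) = f (as ! k)"
    and "concat (map (\<lambda>a. [f a, g a]) as) ! Suc (2 * k) = g (as ! k)"
proof -
  have "concat (map (\<lambda>a. [f a, g a]) as) ! (2 * k) = f (as ! k) \<and>
    concat (map (\<lambda>a. [f a, g a]) as) ! Suc (2 * k) = g (as ! k)"
    using assms
  proof (induction as arbitrary: k)
    case (Cons a as)
    then show ?case by (cases k) auto
  qed simp
  then show "concat (map (\<lambda>a. [f a, g a]) as) ! (2 * k) = f (as ! k)"
    and "concat (map (\<lambda>a. [f a, g a]) as) ! Suc (2 * k) = g (as ! k)" by auto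
qed

lemma coupled_inf_Suc:
  assumes "coupled_inf V" and "even n"
  shows "V (Suc n) = 1 - V n"
proof -
  obtain k where n: "n = 2 * k" using \<open>even n\<close> by blast
  have "coupled (prefix (2 * k + 2) V)"
    using assms(1)[unfolded coupled_inf_def, rule_format, of "2 * k + 2"]
    by simp
  then obtain as where as: "prefix (2 * k + 2) V = concat (map (\<lambda>a. [a, 1 - a]) as)"
    unfolding coupled_def by blast
  have "length (concat (map (\<lambda>a. [a, 1 - a]) as)) = 2 * length as"
    by (induction as) auto
  then have "k < length as"
    using arg_cong[OF as, of length] by simp
  from nth_concat_pairs[OF this, of "\<lambda>a. a" "\<lambda>a. 1 - a", folded as]
  have "V (2 * k) = as ! k" "V (Suc (2 * k)) = 1 - as ! k"
    by (simp_all add: nth_append)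
  then show ?thesis by (simp add: n)
qed

lemma occurs_at_even_odd_alternating:
  assumes V: "coupled_inf V"
    and s: "even s" "occurs_at V s v" and t: "odd t" "occurs_at V t v"
  shows "alternating v"
  unfolding alternating_def
proof (intro allI impI)
  fix k assume k: "Suc k < length v"
  \<comment> \<open>The starts \<open>s\<close> and \<open>t\<close> have opposite parities, so one
    of the two occurrences puts letter \<open>k\<close> of \<open>v\<close> at an even position of
    \<open>V\<close>, where coupling determines the next letter.\<close>
  obtain r where r: "even (r + k)" "occurs_at V r v"
    using s t by (cases "even k") auto
  have "V (r + Suc k) = v ! Suc k" "V (r + k) = v ! k"
    using r(2) k unfolding occurs_at_def by (blast, simp)
  with coupled_inf_Suc[OF V r(1)] show "v ! Suc k = 1 - v ! k" by simp
qed

lemma spacer_length: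
  assumes V: "coupled_inf V" and "\<not> alternating v" and "even s"
    and occ: "occurs_at V s (v @ replicate a 1 @ v)"
  shows "a = length v mod 2"
proof -
  let ?t = "s + length v"
  have v: "occurs_at V s v" "occurs_at V (?t + a) v"
    and ones: "\<And>k. k < a \<Longrightarrow> V (?t + k) = 1"
    using occ by (simp_all add: occurs_at_append) (simp add: occurs_at_def)
  \<comment> \<open>The second copy of \<open>v\<close> cannot start at an odd position, since the
    first starts at an even one and \<open>v\<close> does not alternate.\<close>
  have even: "even (?t + a)"
    using occurs_at_even_odd_alternating[OF V \<open>even s\<close> v(1) _ v(2)] \<open>\<not> alternating v\<close> by blast
  have "a < 2"
  proof (rule ccontr)
    assume "\<not> a < 2"
    \<comment> \<open>The last two letters of the spacer stand at \<open>?t + b\<close> and its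
      successor. As \<open>?t + a\<close> is even, so is \<open>?t + b\<close>, and these two ones
      would form a coupled pair.\<close>
    then obtain b where b: "a = Suc (Suc b)"
      by (metis One_nat_def less_2_cases_iff not0_implies_Suc)
    then have "V (?t + b) = 1" "V (Suc (?t + b)) = 1"
      using ones[of b] ones[of "Suc b"] by simp_all
    moreover have "even (?t + b)" using even b by simp
    ultimately show False
      using coupled_inf_Suc[OF V, of "?t + b"] by simp
  qed
  moreover have "even (length v + a)" using even \<open>even s\<close> by simp
  ultimately show ?thesis by presburger
qed

lemma spaced_Cons: "spaced v (a # as) = v @ replicate a 1 @ spaced v as"
  by (simp add: spaced_def)

lemma spaced_append: "spaced v (as @ b # bs) = spaced v as @ replicate b 1 @ spaced v bs"
  by (simp add: spaced_def)

lemma occurs_at_spaced_hd: "occurs_at V s (spaced v as) \<Longrightarrow> occurs_at V s v"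
  by (cases as) (simp_all add: spaced_Cons occurs_at_append, simp add: spaced_def)

text \<open>The induction moves from one copy of \<open>v\<close> to the next. The start stays even
  because the spacer length just found has the parity of \<open>length v\<close>.\<close>

lemma spacers_constant:
  assumes V: "coupled_inf V" and "\<not> alternating v" and "even s"
    and "occurs_at V s (spaced v as)"
  shows "\<forall>a\<in>set as. a = length v mod 2"
  using assms(3,4)
proof (induction as arbitrary: s)
  case (Cons a as)
  have tail: "occurs_at V (s + length v + a) (spaced v as)"
    using Cons.prems(2) by (simp add: spaced_Cons occurs_at_append)
  have "occurs_at V s (v @ replicate a 1 @ v)"
    using Cons.prems(2) occurs_at_spaced_hd[OF tail]
    by (simp add: spaced_Cons occurs_at_append)
  then have a: "a = length v mod 2"
    by (rule spacer_length[OF V \<open>\<not> alternating v\<close> Cons.prems(1)])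
  then have "even (s + length v + a)"
    using Cons.prems(1) by presburger
  from Cons.IH[OF this tail] a show ?case by simp
qed simp

lemma nth_concat_replicate:
  assumes "n < m * length p"
  shows "concat (replicate m p) ! n = p ! (n mod length p)"
  using assms
proof (induction m arbitrary: n)
  case (Suc m)
  show ?case
  proof (cases "n < length p")
    case False
    then show ?thesis using Suc.IH[of "n - length p"] Suc.prems
      by (simp add: nth_append le_mod_geq)
  qed (simp add: nth_append)
qed simp

lemma length_spaced: "length as * length v \<le> length (spaced v as)"
  by (induction as) (auto simp: spaced_def)

lemma built_from_iff_spaced:
  "built_from w v \<longleftrightarrow> v \<in> words_0_0 \<and> (\<exists>as. as \<noteq> [] \<and> w = spaced v as)"
  by (simp add: built_from_def spaced_def)

text \<open>Each copy of \<open>spaced v as\<close> contributes its inner spacers \<open>as\<close>,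
  followed by the outer spacer \<open>b\<close>. The last copy has no outer spacer after it, hence
  the final \<open>as\<close>.\<close>

lemma spaced_spaced: "spaced (spaced v as) bs = spaced v (concat (map (\<lambda>b. as @ [b]) bs) @ as)"
proof (induction bs)
  case Nil
  then show ?case by (simp add: spaced_def)
next
  case (Cons b bs)
  then show ?case by (simp add: spaced_Cons spaced_append)
qed

text \<open>The bound on \<open>length as\<close> is the point: copies of one fixed
  \<open>v i\<close> fill arbitrarily long words of the construction, so a fact about their spacers
  reaches every position of \<open>V\<close>. Each step adds a spacer because its own list
  \<open>bs\<close> is nonempty.\<close>

lemma built_from_sequence_spaced:
  assumes "\<And>i. built_from (v (Suc i)) (v i)"
  shows "\<exists>as. n \<le> length as \<and> v (i + n) = spaced (v i) as"
proof (induction n)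
  case 0
  show ?case by (rule exI[of _ "[]"]) (simp add: spaced_def)
next
  case (Suc n)
  then obtain as where as: "n \<le> length as" "v (i + n) = spaced (v i) as" by blast
  obtain bs where bs: "bs \<noteq> []" "v (i + Suc n) = spaced (v (i + n)) bs"
    using assms[of "i + n"] by (auto simp: built_from_iff_spaced)
  let ?cs = "concat (map (\<lambda>b. as @ [b]) bs) @ as"
  have "Suc n \<le> length ?cs" using as(1) bs(1) by (cases bs) auto
  moreover have "v (i + Suc n) = spaced (v i) ?cs"
    using as(2) bs(2) spaced_spaced by simp
  ultimately show ?case by blast
qed

lemma periodicI:
  assumes "p \<noteq> []" and "\<And>n. V n = p ! (n mod length p)"
  shows "periodic V"
proof -
  have "V = p\<^sup>\<omega>" by (rule ext) (simp add: iter_def assms)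
  with assms(1) show ?thesis unfolding periodic_def by blast
qed

lemma periodic_if_not_alternating:
  assumes V: "coupled_inf V" and v: "v \<noteq> []" "\<not> alternating v"
    and long: "\<And>n. \<exists>as. n \<le> length as \<and> occurs_at V 0 (spaced v as)"
  shows "periodic V"
proof -
  \<comment> \<open>The period is one copy of \<open>v\<close> together with the spacer that
    \<open>spacers_constant\<close> forces after it.\<close>
  define p where "p = v @ replicate (length v mod 2) 1"
  have p: "p \<noteq> []" using v by (simp add: p_def)
  have "V n = p ! (n mod length p)" for n
  proof -
    obtain as where as: "Suc n \<le> length as" "occurs_at V 0 (spaced v as)"
      using long by blast
    have "map (\<lambda>a. v @ replicate a 1) as = replicate (length as) p"
      using spacers_constant[OF V v(2) _ as(2)]
      by (intro replicate_eqI) (auto simp: p_def)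
    \<comment> \<open>The closing copy of \<open>v\<close> in \<open>spaced v as\<close> is dropped,
      which leaves a pure power of \<open>p\<close>.\<close>
    then have "occurs_at V 0 (concat (replicate (length as) p))"
      using as(2) by (simp add: spaced_def occurs_at_append)
    moreover have "n < length as * length p"
    proof -
      have "n < length as * 1" using as(1) by simp
      also have "\<dots> \<le> length as * length p"
        using p by (intro mult_le_mono2) (simp add: Suc_leI)
      finally show ?thesis .
    qed
    ultimately show ?thesis
      by (simp add: occurs_at_def length_concat sum_list_replicate nth_concat_replicate)
  qed
  with p show ?thesis by (rule periodicI)
qed

lemma periodic_if_Suc_complement:
  fixes V :: "bit word"
  assumes "\<And>n. V (Suc n) = 1 - V n"
  shows "periodic V"
proof -
  have "V n = [V 0, V 1] ! (n mod 2)" for n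
  proof (induction n rule: less_induct)
    case (less n)
    consider "n = 0" | "n = 1" | m where "n = Suc (Suc m)"
      by (metis One_nat_def not0_implies_Suc)
    then show ?case
    proof cases
      case 3
      \<comment> \<open>Complementing twice gives back the same letter, so \<open>V\<close> repeats
        with period two.\<close>
      then show ?thesis using less.IH[of m] assms[of m] assms[of "Suc m"] by simp
    qed simp_all
  qed
  then have "V n = [V 0, V 1] ! (n mod length [V 0, V 1])" for n
    by (metis length_Cons list.size(3) numeral_2_eq_2)
  then show ?thesis by (rule periodicI[rotated]) simp
qed

theorem theorem3p19:
  fixes V :: "bit word"
  assumes "\<not> periodic V"
    and "coupled_inf V"
  shows "\<not> has_rank_one_construction V"
proof
  assume "has_rank_one_construction V"
  then obtain v where v: "\<And>i. v i \<in> words_0_0" "v 0 = [0]"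
    "\<And>i. built_from (v (Suc i)) (v i)" "\<And>i. initial_segment (v i) V"
    unfolding has_rank_one_construction_def by blast
  have occ: "occurs_at V 0 (v i)" for i
    using v(4) by (rule occurs_at_initial_segment)
  have alt: "alternating (v i)" for i
  proof (rule ccontr)
    assume "\<not> alternating (v i)"
    moreover have "v i \<noteq> []" using v(1)[of i] by (simp add: words_0_0_def)
    moreover have "\<exists>as. n \<le> length as \<and> occurs_at V 0 (spaced (v i) as)" for n
      using built_from_sequence_spaced[of v n i, OF v(3)] occ by metis
    ultimately show False
      using periodic_if_not_alternating[OF assms(2)] assms(1) by blast
  qed
  have "V (Suc n) = 1 - V n" for n
  proof -
    \<comment> \<open>Since \<open>v 0\<close> has length one, \<open>n + 2\<close> spacers make
      \<open>v (n + 2)\<close> long enough to contain both positions \<open>n\<close> and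
      \<open>Suc n\<close> of \<open>V\<close>.\<close>
    obtain as where as: "n + 2 \<le> length as" "v (n + 2) = spaced (v 0) as"
      using built_from_sequence_spaced[of v "n + 2" 0, OF v(3)] by auto
    have "Suc n < length (v (n + 2))"
      using as length_spaced[of as "v 0"] by (simp add: v(2))
    then show ?thesis
      using alt[of "n + 2"] occ[of "n + 2"] by (simp add: alternating_def occurs_at_def)
  qed
  then show False
    using periodic_if_Suc_complement assms(1) by blast
qed

end
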